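(* Let $G$ be a finite group with center $\mathrm{Z}(G)$. Then $\mathrm{Aut}(\mathrm{Conj}(G))=\mathrm{Z}(G)\rtimes \mathrm{Aut}(G)$ if and only if either $\mathrm{Z}(G)=1$ or $G$ is (isomorphic to) one of the groups $\mathbb{Z}_2$, $\mathbb{Z}_2^2$ or $\mathbb{Z}_3$.
   Context: A quandle is a set $Q$ with a binary operation $*$ such that (1) $x*x=x$ for all $x\in Q$; (2) for every $x\in Q$ the map $S_x:y\mapsto y*x$ is a bijection of $Q$; (3) $(x*y)*z=(x*z)*(y*z)$ for all $x,y,z\in Q$. An automorphism of $Q$ is a bijection $\varphi:Q\to Q$ with $\varphi(x*y)=\varphi(x)*\varphi(y)$ for all $x,y$; $\mathrm{Aut}(Q)$ is the group of automorphisms. For a group $G$, the conjugation quandle $\mathrm{Conj}(G)$ is the set $G$ with operation $x*y=y^{-1}xy$. $\mathbb{Z}_n$ denotes the cyclic group of order $n$. Every group automorphism of $G$ is an automorphism of $\mathrm{Conj}(G)$, and for $a\in \mathrm{Z}(G)$ the map $t_a:x\mapsto xa$ is an automorphism of $\mathrm{Conj}(G)$. The set $\{t_a\varphi \mid a\in \mathrm{Z}(G),\ \varphi\in\mathrm{Aut}(G)\}$ is a subgroup of $\mathrm{Aut}(\mathrm{Conj}(G))$ isomorphic to the semidirect product $\mathrm{Z}(G)\rtimes\mathrm{Aut}(G)$ (with the natural action of $\mathrm{Aut}(G)$ on $\mathrm{Z}(G)$). The equality $\mathrm{Aut}(\mathrm{Conj}(G))=\mathrm{Z}(G)\rtimes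 \mathrm{Aut}(G)$ means that this subgroup is the whole group $\mathrm{Aut}(\mathrm{Conj}(G))$. *)

theory Defs
  imports "HOL-Algebra.Algebra"
begin

record 'a quandle = "'a partial_object" +
  qop :: "['a, 'a] \<Rightarrow> 'a" (infixl \<open>\<star>\<index>\<close> 70)

locale quandle =
  fixes Q (structure)
  assumes idem: "x \<in> carrier Q \<Longrightarrow> x \<star> x = x"
    and right_bij: "x \<in> carrier Q \<Longrightarrow> bij_betw (\<lambda>y. y \<star> x) (carrier Q) (carrier Q)"
    and self_distrib: "\<lbrakk>x \<in> carrier Q; y \<in> carrier Q; z \<in> carrier Q\<rbrakk>
      \<Longrightarrow> (x \<star> y) \<star> z = (x \<star> z) \<star> (y \<star> z)"

text \<open>As for \<^const>\<open>auto\<close> on groups, automorphisms are extensional functions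
  (\<^const>\<open>Bij\<close>), so that equality of automorphisms is equality on the carrier.\<close>

definition quandle_auto :: "('a, 'm) quandle_scheme \<Rightarrow> ('a \<Rightarrow> 'a) set"
  where "quandle_auto Q = {f \<in> Bij (carrier Q).
    \<forall>x\<in>carrier Q. \<forall>y\<in>carrier Q. f (x \<star>\<^bsub>Q\<^esub> y) = f x \<star>\<^bsub>Q\<^esub> f y}"

definition quandle_AutoGroup :: "('a, 'm) quandle_scheme \<Rightarrow> ('a \<Rightarrow> 'a) monoid"
  where "quandle_AutoGroup Q = BijGroup (carrier Q) \<lparr>carrier := quandle_auto Q\<rparr>"

definition Conj :: "('a, 'm) monoid_scheme \<Rightarrow> 'a quandle"
  where "Conj G = \<lparr>carrier = carrier G, qop = (\<lambda>x y. inv\<^bsub>G\<^esub> y \<otimes>\<^bsub>G\<^esub> x \<otimes>\<^bsub>G\<^esub> y)\<rparr>"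

definition group_center :: "('a, 'm) monoid_scheme \<Rightarrow> 'a set"
  where "group_center G = {a \<in> carrier G. \<forall>x\<in>carrier G. a \<otimes>\<^bsub>G\<^esub> x = x \<otimes>\<^bsub>G\<^esub> a}"

definition center_translation :: "('a, 'm) monoid_scheme \<Rightarrow> 'a \<Rightarrow> 'a \<Rightarrow> 'a"
  where "center_translation G a = (\<lambda>x\<in>carrier G. x \<otimes>\<^bsub>G\<^esub> a)"

definition center_auto_maps :: "('a, 'm) monoid_scheme \<Rightarrow> ('a \<Rightarrow> 'a) set"
  where "center_auto_maps G =
    {compose (carrier G) (center_translation G a) \<phi> | a \<phi>. a \<in> group_center G \<and> \<phi> \<in> auto G}"

definition center_semidirect_auto :: "('a, 'm) monoid_scheme \<Rightarrow> ('a \<times> ('a \<Rightarrow> 'a)) monoid"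
  where "center_semidirect_auto G =
    \<lparr>carrier = group_center G \<times> auto G,
     monoid.mult = (\<lambda>(a, \<phi>) (b, \<psi>). (a \<otimes>\<^bsub>G\<^esub> \<phi> b, \<phi> \<otimes>\<^bsub>AutoGroup G\<^esub> \<psi>)),
     one = (\<one>\<^bsub>G\<^esub>, \<one>\<^bsub>AutoGroup G\<^esub>)\<rparr>"

lemma carrier_Conj [simp]: "carrier (Conj G) = carrier G"
  by (simp add: Conj_def)

lemma carrier_quandle_AutoGroup [simp]: "carrier (quandle_AutoGroup Q) = quandle_auto Q"
  by (simp add: quandle_AutoGroup_def)

lemma qop_Conj [simp]: "x \<star>\<^bsub>Conj G\<^esub> y = inv\<^bsub>G\<^esub> y \<otimes>\<^bsub>G\<^esub> x \<otimes>\<^bsub>G\<^esub> y"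
  by (simp add: Conj_def)

lemma (in group) quandle_Conj: "quandle (Conj G)"
proof
  fix x assume x: "x \<in> carrier (Conj G)"
  then show "x \<star>\<^bsub>Conj G\<^esub> x = x" by simp
  show "bij_betw (\<lambda>y. y \<star>\<^bsub>Conj G\<^esub> x) (carrier (Conj G)) (carrier (Conj G))"
    by (rule bij_betw_byWitness[where f' = "\<lambda>y. x \<otimes> y \<otimes> inv x"])
      (use x in \<open>auto simp: m_assoc, auto simp: m_assoc[symmetric]\<close>)
next
  fix x y z assume "x \<in> carrier (Conj G)" "y \<in> carrier (Conj G)" "z \<in> carrier (Conj G)"
  then show "(x \<star>\<^bsub>Conj G\<^esub> y) \<star>\<^bsub>Conj G\<^esub> z =
      (x \<star>\<^bsub>Conj G\<^esub> z) \<star>\<^bsub>Conj G\<^esub> (y \<star>\<^bsub>Conj G\<^esub> z)"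
    by (simp add: inv_mult_group m_assoc inv_solve_left inv_solve_left' flip: m_assoc)
       (simp add: m_assoc)
qed

lemma (in quandle) subgroup_quandle_auto:
  "subgroup (quandle_auto Q) (BijGroup (carrier Q))"
proof -
  have cl: "x \<star> y \<in> carrier Q" if "x \<in> carrier Q" "y \<in> carrier Q" for x y
    using right_bij[OF that(2)] that(1) by (auto simp: bij_betw_def)
  show ?thesis
  proof
    show "quandle_auto Q \<subseteq> carrier (BijGroup (carrier Q))"
      by (auto simp: quandle_auto_def BijGroup_def)
    show "\<one>\<^bsub>BijGroup (carrier Q)\<^esub> \<in> quandle_auto Q"
      by (auto simp: quandle_auto_def BijGroup_def id_Bij cl)
  next
    fix f g assume "f \<in> quandle_auto Q" "g \<in> quandle_auto Q"
    then show "f \<otimes>\<^bsub>BijGroup (carrier Q)\<^esub> g \<in> quandle_auto Q"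
      using Bij_imp_funcset[of g "carrier Q"]
      by (auto simp: quandle_auto_def BijGroup_def compose_Bij cl compose_eq Pi_iff)
  next
    fix f assume f: "f \<in> quandle_auto Q"
    then show "inv\<^bsub>BijGroup (carrier Q)\<^esub> f \<in> quandle_auto Q"
      using Bij_inv_into_lemma[of "carrier Q" f "qop Q"]
      by (auto simp: quandle_auto_def inv_BijGroup restrict_inv_into_Bij cl)
  qed
qed

lemma (in quandle) group_quandle_AutoGroup: "group (quandle_AutoGroup Q)"
  unfolding quandle_AutoGroup_def
  by (rule subgroup.subgroup_is_group[OF subgroup_quandle_auto group_BijGroup])

text \<open>The semidirect product embeds into the automorphism group of the conjugation quandle,
  with image \<^term>\<open>center_auto_maps G\<close>.\<close>

lemma (in group) auto_closed: "\<lbrakk>\<phi> \<in> auto G; x \<in> carrier G\<rbrakk> \<Longrightarrow> \<phi> x \<in> carrier G"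
  by (auto simp: auto_def hom_def)

lemma (in group) auto_mult:
  "\<lbrakk>\<phi> \<in> auto G; x \<in> carrier G; y \<in> carrier G\<rbrakk> \<Longrightarrow> \<phi> (x \<otimes> y) = \<phi> x \<otimes> \<phi> y"
  by (auto simp: auto_def hom_def)

lemma (in group) auto_center:
  assumes "\<phi> \<in> auto G" "a \<in> group_center G" shows "\<phi> a \<in> group_center G"
proof -
  have a: "a \<in> carrier G" "\<And>x. x \<in> carrier G \<Longrightarrow> a \<otimes> x = x \<otimes> a"
    using assms(2) by (auto simp: group_center_def)
  have "\<phi> a \<otimes> y = y \<otimes> \<phi> a" if "y \<in> carrier G" for y
  proof -
    have "y \<in> \<phi> ` carrier G"
      using assms(1) that by (simp add: auto_def Bij_def bij_betw_def)
    then obtain x where x: "x \<in> carrier G" "y = \<phi> x" by blast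
    show ?thesis using a x auto_mult[OF assms(1)] by metis
  qed
  then show ?thesis using a auto_closed[OF assms(1)] by (auto simp: group_center_def)
qed

lemma (in group) center_auto_map_mem:
  assumes a: "a \<in> group_center G" and \<phi>: "\<phi> \<in> auto G"
  shows "compose (carrier G) (center_translation G a) \<phi> \<in> quandle_auto (Conj G)"
proof -
  have ac: "a \<in> carrier G" and comm: "\<And>x. x \<in> carrier G \<Longrightarrow> a \<otimes> x = x \<otimes> a"
    using a by (auto simp: group_center_def)
  have t: "center_translation G a \<in> Bij (carrier G)"
    unfolding Bij_def center_translation_def
    by (auto simp: bij_betw_restrict_eq intro!: bij_betw_byWitness[where f' = "\<lambda>y. y \<otimes> inv a"])
       (use ac in \<open>auto simp: m_assoc\<close>)
  have inv: "\<phi> (inv y) = inv (\<phi> y)" if "y \<in> carrier G" for y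
    using \<phi> that by (auto simp: auto_def intro!: group_hom.hom_inv group_hom.intro
      group_hom_axioms.intro is_group)
  have conj: "inv y \<otimes> x \<otimes> y \<otimes> a = inv (y \<otimes> a) \<otimes> (x \<otimes> a) \<otimes> (y \<otimes> a)"
    if "x \<in> carrier G" "y \<in> carrier G" for x y
  proof -
    have "inv (y \<otimes> a) \<otimes> (x \<otimes> a) \<otimes> (y \<otimes> a) = inv (a \<otimes> y) \<otimes> (a \<otimes> x) \<otimes> (y \<otimes> a)"
      using that comm by simp
    also have "\<dots> = inv y \<otimes> x \<otimes> y \<otimes> a"
      using that ac by (simp add: inv_mult_group m_assoc inv_solve_left) (simp flip: m_assoc)
    finally show ?thesis ..
  qed
  show ?thesis
    using t \<phi> by (auto simp: quandle_auto_def auto_def[of G] intro!: compose_Bij)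
      (simp add: compose_eq center_translation_def auto_closed[OF \<phi>] auto_mult[OF \<phi>] inv conj)
qed

lemma (in group) center_semidirect_auto_embedding:
  defines "\<theta> \<equiv> \<lambda>(a, \<phi>). compose (carrier G) (center_translation G a) \<phi>"
  shows "\<theta> \<in> mon (center_semidirect_auto G) (quandle_AutoGroup (Conj G))"
    and "\<theta> ` carrier (center_semidirect_auto G) = center_auto_maps G"
proof -
  show "\<theta> ` carrier (center_semidirect_auto G) = center_auto_maps G"
    by (auto simp: \<theta>_def center_semidirect_auto_def center_auto_maps_def image_def)
  have mem: "\<theta> (a, \<phi>) \<in> quandle_auto (Conj G)" if "a \<in> group_center G" "\<phi> \<in> auto G" for a \<phi>
    using center_auto_map_mem[OF that] by (simp add: \<theta>_def)
  have ap: "\<theta> (a, \<phi>) x = \<phi> x \<otimes> a" if "x \<in> carrier G" "\<phi> \<in> auto G" for a \<phi> x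
    using that by (simp add: \<theta>_def compose_eq center_translation_def auto_closed)
  have cc: "a \<in> carrier G" if "a \<in> group_center G" for a
    using that by (simp add: group_center_def)
  have am: "\<phi> \<otimes>\<^bsub>AutoGroup G\<^esub> \<psi> = compose (carrier G) \<phi> \<psi>"
    if "\<phi> \<in> auto G" "\<psi> \<in> auto G" for \<phi> \<psi>
    using that by (simp add: AutoGroup_def BijGroup_def auto_def)
  have acl: "compose (carrier G) \<phi> \<psi> \<in> auto G"
    if "\<phi> \<in> auto G" "\<psi> \<in> auto G" for \<phi> \<psi>
    using subgroup.m_closed[OF subgroup_auto that] that
    by (simp add: BijGroup_def auto_def)
  have qm: "f \<otimes>\<^bsub>quandle_AutoGroup (Conj G)\<^esub> g = compose (carrier G) f g"
    if "f \<in> quandle_auto (Conj G)" "g \<in> quandle_auto (Conj G)" for f g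
    using that by (simp add: quandle_AutoGroup_def BijGroup_def quandle_auto_def)
  have mult: "\<theta> (a \<otimes> \<phi> b, compose (carrier G) \<phi> \<psi>)
      = compose (carrier G) (\<theta> (a, \<phi>)) (\<theta> (b, \<psi>))"
    if *: "a \<in> group_center G" "\<phi> \<in> auto G" "b \<in> group_center G" "\<psi> \<in> auto G" for a \<phi> b \<psi>
  proof
    fix x
    show "\<theta> (a \<otimes> \<phi> b, compose (carrier G) \<phi> \<psi>) x
      = compose (carrier G) (\<theta> (a, \<phi>)) (\<theta> (b, \<psi>)) x"
    proof (cases "x \<in> carrier G")
      case True
      have "a \<otimes> \<phi> b = \<phi> b \<otimes> a"
        using * by (simp add: group_center_def auto_closed)
      then show ?thesis
        using True * by (simp add: ap acl compose_eq auto_closed auto_mult cc m_assoc)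
    qed (simp add: \<theta>_def compose_def)
  qed
  have "inj_on \<theta> (group_center G \<times> auto G)"
  proof (rule inj_onI, clarify)
    fix a \<phi> b \<psi>
    assume *: "a \<in> group_center G" "\<phi> \<in> auto G" "b \<in> group_center G" "\<psi> \<in> auto G"
      and eq: "\<theta> (a, \<phi>) = \<theta> (b, \<psi>)"
    have one: "\<chi> \<one> = \<one>" if "\<chi> \<in> auto G" for \<chi>
      using that hom_one[of \<chi> G G] by (simp add: auto_def is_group)
    have ab: "a = b"
      using fun_cong[OF eq, of \<one>] * by (simp add: ap one cc)
    have "\<phi> x = \<psi> x" if "x \<in> carrier G" for x
      using fun_cong[OF eq, of x] * that by (simp add: ap ab cc auto_closed)
    moreover have "\<phi> \<in> extensional (carrier G)" "\<psi> \<in> extensional (carrier G)"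
      using * by (auto simp: auto_def Bij_def)
    ultimately show "a = b \<and> \<phi> = \<psi>" using ab by (blast intro: extensionalityI)
  qed
  then show "\<theta> \<in> mon (center_semidirect_auto G) (quandle_AutoGroup (Conj G))"
    by (auto simp: mon_def hom_def center_semidirect_auto_def mem am qm mult)
qed

end

theory Submission
  imports Defs
begin

text \<open>An automorphism \<open>f\<close> of \<open>Conj G\<close> has the form \<open>t\<^sub>a \<phi>\<close> iff
  \<open>f (x \<otimes> y) \<otimes> f \<one> = f x \<otimes> f y\<close> for all \<open>x\<close>, \<open>y\<close>. Both \<open>f (x \<otimes> y)\<close> and \<open>f x \<otimes> f y\<close>
  induce the same inner automorphism, so this always holds when the centre is trivial. If \<open>a \<noteq> \<one>\<close> is
  central and \<open>G\<close> is not abelian, multiplying by \<open>a\<close> on the centre only is an automorphism violating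
  the condition for every non-commuting pair \<open>x\<close>, \<open>y\<close>. If \<open>G\<close> is abelian, every permutation is an automorphism of \<open>Conj G\<close>; testing the
  condition on transpositions fixing \<open>\<one>\<close> leaves only the groups listed.\<close>

section \<open>Groups in which every permutation is affine: transport and the models\<close>

definition permutations_affine :: "('a, 'm) monoid_scheme \<Rightarrow> bool"
  where "permutations_affine G \<longleftrightarrow> (\<forall>f. bij_betw f (carrier G) (carrier G) \<longrightarrow>
    (\<forall>x\<in>carrier G. \<forall>y\<in>carrier G. f (x \<otimes>\<^bsub>G\<^esub> y) \<otimes>\<^bsub>G\<^esub> f \<one>\<^bsub>G\<^esub> = f x \<otimes>\<^bsub>G\<^esub> f y))"

text \<open>An isomorphism \<open>h\<close> carries a permutation \<open>f\<close> of
  \<open>G\<close> to the permutation \<open>h \<circ> f \<circ> k\<close> of \<open>H\<close>,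
  where \<open>k\<close> inverts \<open>h\<close>. The identity holds there and is pulled back by
  injectivity of \<open>h\<close>.\<close>

lemma permutations_affine_iso:
  assumes "group G" "group H" "G \<cong> H" "permutations_affine H"
  shows "permutations_affine G"
  unfolding permutations_affine_def
proof (intro allI impI ballI)
  interpret G: group G by fact
  interpret H: group H by fact
  fix f x y
  assume f: "bij_betw f (carrier G) (carrier G)" and xy: "x \<in> carrier G" "y \<in> carrier G"
  obtain h where h: "h \<in> hom G H" "bij_betw h (carrier G) (carrier H)"
    using assms(3) by (auto simp: is_iso_def iso_def)
  define k where "k = the_inv_into (carrier G) h"
  have k: "bij_betw k (carrier H) (carrier G)"
    unfolding k_def by (rule bij_betw_the_inv_into[OF h(2)])
  have kh: "k (h z) = z" if "z \<in> carrier G" for z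
    using h(2) that by (simp add: k_def bij_betw_def the_inv_into_f_f)
  have hc: "h z \<in> carrier H" if "z \<in> carrier G" for z
    using h(1) that by (rule hom_in_carrier)
  have fc: "f z \<in> carrier G" if "z \<in> carrier G" for z
    using f that by (rule bij_betw_apply)
  have "bij_betw (h \<circ> f \<circ> k) (carrier H) (carrier H)"
    using f h(2) k by (blast intro: bij_betw_trans)
  then have aff: "(h \<circ> f \<circ> k) (h x \<otimes>\<^bsub>H\<^esub> h y) \<otimes>\<^bsub>H\<^esub> (h \<circ> f \<circ> k) \<one>\<^bsub>H\<^esub> =
      (h \<circ> f \<circ> k) (h x) \<otimes>\<^bsub>H\<^esub> (h \<circ> f \<circ> k) (h y)"
    using assms(4) xy hc unfolding permutations_affine_def by blast
  have one: "\<one>\<^bsub>H\<^esub> = h \<one>\<^bsub>G\<^esub>"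
    using hom_one[OF h(1) assms(1,2)] by simp
  have "h (f (x \<otimes>\<^bsub>G\<^esub> y) \<otimes>\<^bsub>G\<^esub> f \<one>\<^bsub>G\<^esub>) = h (f x \<otimes>\<^bsub>G\<^esub> f y)"
    using aff xy fc by (simp add: one kh hom_mult[OF h(1)] flip: hom_mult[OF h(1)])
  then show "f (x \<otimes>\<^bsub>G\<^esub> y) \<otimes>\<^bsub>G\<^esub> f \<one>\<^bsub>G\<^esub> = f x \<otimes>\<^bsub>G\<^esub> f y"
    using h(2) xy fc by (intro inj_onD[of h "carrier G"]) (auto simp: bij_betw_def)
qed

lemma carrier_integer_mod_group_2: "carrier (integer_mod_group 2) = {0, 1}"
  by (auto simp: carrier_integer_mod_group)

lemma carrier_integer_mod_group_3: "carrier (integer_mod_group 3) = {0, 1, 2}"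
  by (auto simp: carrier_integer_mod_group)

lemma permutations_affine_Z2: "permutations_affine (integer_mod_group 2)"
  unfolding permutations_affine_def
proof (intro allI impI)
  fix f :: "int \<Rightarrow> int"
  assume "bij_betw f (carrier (integer_mod_group 2)) (carrier (integer_mod_group 2))"
  then have "f 0 \<in> {0, 1}" "f 1 \<in> {0, 1}" "f 0 \<noteq> f 1"
    by (auto simp: bij_betw_def carrier_integer_mod_group_2)
  then show "\<forall>x\<in>carrier (integer_mod_group 2). \<forall>y\<in>carrier (integer_mod_group 2).
      f (x \<otimes>\<^bsub>integer_mod_group 2\<^esub> y) \<otimes>\<^bsub>integer_mod_group 2\<^esub> f \<one>\<^bsub>integer_mod_group 2\<^esub> =
      f x \<otimes>\<^bsub>integer_mod_group 2\<^esub> f y"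
    by (auto simp: carrier_integer_mod_group_2)
qed

lemma permutations_affine_Z3: "permutations_affine (integer_mod_group 3)"
  unfolding permutations_affine_def
proof (intro allI impI)
  fix f :: "int \<Rightarrow> int"
  assume "bij_betw f (carrier (integer_mod_group 3)) (carrier (integer_mod_group 3))"
  \<comment> \<open>Bijectivity enters only through these constraints; they leave six value tables
    to check.\<close>
  then have "f 0 \<in> {0, 1, 2}" "f 1 \<in> {0, 1, 2}" "f 2 \<in> {0, 1, 2}"
    "f 0 \<noteq> f 1" "f 0 \<noteq> f 2" "f 1 \<noteq> f 2"
    by (auto simp: bij_betw_def carrier_integer_mod_group_3)
  then show "\<forall>x\<in>carrier (integer_mod_group 3). \<forall>y\<in>carrier (integer_mod_group 3).
      f (x \<otimes>\<^bsub>integer_mod_group 3\<^esub> y) \<otimes>\<^bsub>integer_mod_group 3\<^esub> f \<one>\<^bsub>integer_mod_group 3\<^esub> =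
      f x \<otimes>\<^bsub>integer_mod_group 3\<^esub> f y"
    by (auto simp: carrier_integer_mod_group_3)
qed

text \<open>The four elements multiply to the identity and each is its own inverse, so two
  complementary pairs have equal products. For distinct \<open>x\<close>, \<open>y\<close> other
  than the identity, \<open>x \<otimes> y\<close>, the identity, \<open>x\<close> and
  \<open>y\<close> are the whole group, and \<open>f\<close> permutes them. The degenerate cases
  follow from the unit laws and from squares being trivial.\<close>

lemma permutations_affine_Klein:
  "permutations_affine (integer_mod_group 2 \<times>\<times> integer_mod_group 2)" (is "permutations_affine ?K")
  unfolding permutations_affine_def
proof (intro allI impI ballI)
  fix f :: "int \<times> int \<Rightarrow> int \<times> int" and x y
  assume f: "bij_betw f (carrier ?K) (carrier ?K)" and x: "x \<in> carrier ?K" and y: "y \<in> carrier ?K"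
  have K: "carrier ?K = {(0, 0), (0, 1), (1, 0), (1, 1)}"
    by (auto simp: carrier_integer_mod_group_2)
  have distinct: "p \<otimes>\<^bsub>?K\<^esub> q = r \<otimes>\<^bsub>?K\<^esub> s"
    if "p \<in> carrier ?K" "q \<in> carrier ?K" "r \<in> carrier ?K" "s \<in> carrier ?K"
      "p \<noteq> q" "p \<noteq> r" "p \<noteq> s" "q \<noteq> r" "q \<noteq> s" "r \<noteq> s" for p q r s
    using that unfolding K by auto
  have square: "p \<otimes>\<^bsub>?K\<^esub> p = \<one>\<^bsub>?K\<^esub>" if "p \<in> carrier ?K" for p
    using that unfolding K by auto
  have unit: "p \<otimes>\<^bsub>?K\<^esub> \<one>\<^bsub>?K\<^esub> = p" "\<one>\<^bsub>?K\<^esub> \<otimes>\<^bsub>?K\<^esub> p = p" if "p \<in> carrier ?K" for p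
    using that unfolding K by auto
  have comm: "p \<otimes>\<^bsub>?K\<^esub> q = q \<otimes>\<^bsub>?K\<^esub> p" for p q
    by (simp add: mult_DirProd' add.commute)
  have one: "\<one>\<^bsub>?K\<^esub> \<in> carrier ?K"
    by simp
  have fc: "f p \<in> carrier ?K" if "p \<in> carrier ?K" for p
    using f that by (rule bij_betw_apply)
  have f_eq: "f p = f q \<longleftrightarrow> p = q" if "p \<in> carrier ?K" "q \<in> carrier ?K" for p q
    using f that by (auto simp: bij_betw_def dest: inj_onD)
  consider "x = \<one>\<^bsub>?K\<^esub>" | "y = \<one>\<^bsub>?K\<^esub>" | "x = y"
    | "x \<noteq> \<one>\<^bsub>?K\<^esub>" "y \<noteq> \<one>\<^bsub>?K\<^esub>" "x \<noteq> y" by blast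
  then show "f (x \<otimes>\<^bsub>?K\<^esub> y) \<otimes>\<^bsub>?K\<^esub> f \<one>\<^bsub>?K\<^esub> = f x \<otimes>\<^bsub>?K\<^esub> f y"
  proof cases
    case 1
    show ?thesis unfolding 1 unit(2)[OF y] by (rule comm)
  next
    case 2
    show ?thesis unfolding 2 unit(1)[OF x] ..
  next
    case 3
    show ?thesis unfolding 3 square[OF y] square[OF fc[OF y]] square[OF fc[OF one]] ..
  next
    case 4
    then have "x \<otimes>\<^bsub>?K\<^esub> y \<in> carrier ?K" "x \<otimes>\<^bsub>?K\<^esub> y \<noteq> \<one>\<^bsub>?K\<^esub>"
      "x \<otimes>\<^bsub>?K\<^esub> y \<noteq> x" "x \<otimes>\<^bsub>?K\<^esub> y \<noteq> y"
      using x y unfolding K by auto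
    then show ?thesis
      using 4 x y one by (intro distinct fc) (simp_all only: f_eq not_False_eq_True, simp_all)
  qed
qed

section \<open>Quandle automorphisms and the pointwise criterion\<close>

context group
begin

lemma group_centerD:
  assumes "a \<in> group_center G"
  shows "a \<in> carrier G" "\<And>x. x \<in> carrier G \<Longrightarrow> a \<otimes> x = x \<otimes> a"
  using assms by (auto simp: group_center_def)

lemma inv_group_center:
  assumes "a \<in> group_center G" shows "inv a \<in> group_center G"
proof -
  have "inv a \<otimes> x = x \<otimes> inv a" if "x \<in> carrier G" for x
    using that group_centerD[OF assms] by (metis inv_closed inv_solve_left inv_solve_right m_assoc m_closed)
  then show ?thesis
    using group_centerD(1)[OF assms] by (auto simp: group_center_def)
qed

lemma mult_group_center:
  assumes a: "a \<in> group_center G" and b: "b \<in> group_center G"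
  shows "a \<otimes> b \<in> group_center G"
proof -
  have "a \<otimes> b \<otimes> x = x \<otimes> (a \<otimes> b)" if "x \<in> carrier G" for x
    using that group_centerD[OF a] group_centerD[OF b] by (metis m_assoc)
  then show ?thesis
    using group_centerD(1)[OF a] group_centerD(1)[OF b] by (auto simp: group_center_def)
qed

lemma quandle_auto_ConjD:
  assumes "f \<in> quandle_auto (Conj G)"
  shows "bij_betw f (carrier G) (carrier G)" "f \<in> extensional (carrier G)"
    "\<And>x. x \<in> carrier G \<Longrightarrow> f x \<in> carrier G"
    "\<And>x y. x \<in> carrier G \<Longrightarrow> y \<in> carrier G \<Longrightarrow> f (inv y \<otimes> x \<otimes> y) = inv (f y) \<otimes> f x \<otimes> f y"
  using assms by (auto simp: quandle_auto_def Bij_def bij_betw_apply)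

lemma quandle_auto_ConjI:
  assumes "bij_betw f (carrier G) (carrier G)"
    and "\<And>x y. x \<in> carrier G \<Longrightarrow> y \<in> carrier G \<Longrightarrow> f (inv y \<otimes> x \<otimes> y) = inv (f y) \<otimes> f x \<otimes> f y"
  shows "restrict f (carrier G) \<in> quandle_auto (Conj G)"
  using assms by (auto simp: quandle_auto_def Bij_def cong: bij_betw_cong)

text \<open>Conjugation by the identity is trivial, so conjugation by \<open>f \<one>\<close> fixes
  every value of \<open>f\<close>, and \<open>f\<close> is surjective.\<close>

lemma quandle_auto_one_center:
  assumes f: "f \<in> quandle_auto (Conj G)"
  shows "f \<one> \<in> group_center G"
proof -
  note fD = quandle_auto_ConjD[OF f]
  have "f \<one> \<otimes> z = z \<otimes> f \<one>" if z: "z \<in> carrier G" for z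
  proof -
    obtain y where y: "y \<in> carrier G" "z = f y"
      using fD(1) z by (auto simp: bij_betw_def)
    have "f y = inv (f \<one>) \<otimes> f y \<otimes> f \<one>"
      using fD(4)[of y \<one>] y by simp
    then show ?thesis
      using y fD(3) by (metis inv_solve_left m_assoc one_closed inv_closed m_closed)
  qed
  then show ?thesis using fD(3) by (auto simp: group_center_def)
qed

text \<open>Since a group automorphism fixes the identity, the translation can only be by
  \<open>a = f \<one>\<close>. Dividing \<open>f\<close> by this central element leaves a bijection,
  and the identity says exactly that this bijection is a homomorphism.\<close>

lemma center_auto_maps_iff:
  assumes f: "f \<in> quandle_auto (Conj G)"
  shows "f \<in> center_auto_maps G \<longleftrightarrow>
    (\<forall>x\<in>carrier G. \<forall>y\<in>carrier G. f (x \<otimes> y) \<otimes> f \<one> = f x \<otimes> f y)"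
proof
  assume "f \<in> center_auto_maps G"
  then obtain a \<phi> where a: "a \<in> group_center G" and \<phi>: "\<phi> \<in> auto G"
    and f_eq: "f = compose (carrier G) (center_translation G a) \<phi>"
    by (auto simp: center_auto_maps_def)
  have ap: "f x = \<phi> x \<otimes> a" if "x \<in> carrier G" for x
    using that \<phi> by (simp add: f_eq compose_eq center_translation_def auto_closed)
  have "\<phi> \<one> = \<one>"
    using \<phi> hom_one[of \<phi> G G] by (simp add: auto_def is_group)
  moreover have "\<phi> x \<otimes> \<phi> y \<otimes> a \<otimes> a = \<phi> x \<otimes> a \<otimes> (\<phi> y \<otimes> a)"
    if "x \<in> carrier G" "y \<in> carrier G" for x y
    using that group_centerD[OF a] auto_closed[OF \<phi>] by (metis m_assoc m_closed)
  ultimately show "\<forall>x\<in>carrier G. \<forall>y\<in>carrier G. f (x \<otimes> y) \<otimes> f \<one> = f x \<otimes> f y"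
    using group_centerD[OF a] by (simp add: ap auto_mult[OF \<phi>])
next
  assume aff: "\<forall>x\<in>carrier G. \<forall>y\<in>carrier G. f (x \<otimes> y) \<otimes> f \<one> = f x \<otimes> f y"
  note fD = quandle_auto_ConjD[OF f]
  define a where "a = f \<one>"
  have a: "a \<in> group_center G" using quandle_auto_one_center[OF f] by (simp add: a_def)
  note aD = group_centerD[OF a] and iaD = group_centerD[OF inv_group_center[OF a]]
  define \<phi> where "\<phi> = (\<lambda>x\<in>carrier G. f x \<otimes> inv a)"
  have "bij_betw (\<lambda>x. x \<otimes> inv a) (carrier G) (carrier G)"
    by (rule bij_betw_byWitness[where f' = "\<lambda>x. x \<otimes> a"]) (use aD in \<open>auto simp: m_assoc\<close>)
  from bij_betw_trans[OF fD(1) this]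
  have "\<phi> \<in> Bij (carrier G)"
    by (simp add: Bij_def \<phi>_def comp_def cong: bij_betw_cong)
  moreover have "\<phi> \<in> hom G G"
  proof (rule homI)
    fix x y assume xy: "x \<in> carrier G" "y \<in> carrier G"
    have "f (x \<otimes> y) = f x \<otimes> f y \<otimes> inv a"
      using aff xy fD(3) aD(1) by (metis a_def inv_solve_right m_closed)
    then have "\<phi> (x \<otimes> y) = f x \<otimes> (f y \<otimes> inv a) \<otimes> inv a"
      using xy fD(3) aD(1) by (simp add: \<phi>_def m_assoc)
    \<comment> \<open>Centrality of \<open>inv a\<close> moves one of its two copies next to
      \<open>f x\<close>, so that both factors become values of \<open>\<phi>\<close>.\<close>
    also have "\<dots> = f x \<otimes> (inv a \<otimes> (f y \<otimes> inv a))"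
      using xy fD(3) aD(1) iaD(2)[of "f y \<otimes> inv a"] by (simp add: m_assoc)
    finally show "\<phi> (x \<otimes> y) = \<phi> x \<otimes> \<phi> y"
      using xy fD(3) aD(1) by (simp add: \<phi>_def m_assoc)
  qed (use fD(3) aD(1) in \<open>simp add: \<phi>_def\<close>)
  ultimately have \<phi>: "\<phi> \<in> auto G" by (simp add: auto_def)
  have "f = compose (carrier G) (center_translation G a) \<phi>"
  proof (rule extensionalityI[OF fD(2)])
    fix x assume "x \<in> carrier G"
    then show "f x = compose (carrier G) (center_translation G a) \<phi> x"
      using fD(3) aD(1) by (simp add: compose_eq center_translation_def \<phi>_def m_assoc)
  qed simp
  with a \<phi> show "f \<in> center_auto_maps G"
    by (auto simp: center_auto_maps_def)
qed

text \<open>One inclusion always holds by \<open>center_auto_map_mem\<close>, so equality amounts to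
  the criterion for every automorphism.\<close>

lemma quandle_auto_eq_center_auto_maps_iff:
  "quandle_auto (Conj G) = center_auto_maps G \<longleftrightarrow>
    (\<forall>f\<in>quandle_auto (Conj G). \<forall>x\<in>carrier G. \<forall>y\<in>carrier G. f (x \<otimes> y) \<otimes> f \<one> = f x \<otimes> f y)"
proof -
  have "center_auto_maps G \<subseteq> quandle_auto (Conj G)"
    by (auto simp: center_auto_maps_def center_auto_map_mem)
  then show ?thesis
    using center_auto_maps_iff by blast
qed

section \<open>Multiplicativity modulo the centre, and trivial centre\<close>

text \<open>Conjugating by \<open>x \<otimes> y\<close> is conjugating by \<open>x\<close> and then
  by \<open>y\<close>. Applying \<open>f\<close> shows that \<open>f (x \<otimes> y)\<close> and
  \<open>f x \<otimes> f y\<close> conjugate every value of \<open>f\<close>, hence every element,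
  in the same way; they therefore differ by a central factor.\<close>

lemma quandle_auto_mult_mod_center:
  assumes f: "f \<in> quandle_auto (Conj G)" and xy: "x \<in> carrier G" "y \<in> carrier G"
  shows "f (x \<otimes> y) \<otimes> inv (f x \<otimes> f y) \<in> group_center G"
proof -
  note fD = quandle_auto_ConjD[OF f]
  define u where "u = f (x \<otimes> y)"
  define v where "v = f x \<otimes> f y"
  have uv: "u \<in> carrier G" "v \<in> carrier G" using xy fD(3) by (auto simp: u_def v_def)
  have "u \<otimes> inv v \<otimes> w = w \<otimes> (u \<otimes> inv v)" if w: "w \<in> carrier G" for w
  proof -
    obtain z where z: "z \<in> carrier G" "w = f z"
      using fD(1) w by (auto simp: bij_betw_def)
    have "inv u \<otimes> w \<otimes> u = f (inv (x \<otimes> y) \<otimes> z \<otimes> (x \<otimes> y))"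
      using fD(4) xy z by (simp add: u_def)
    also have "\<dots> = f (inv y \<otimes> (inv x \<otimes> z \<otimes> x) \<otimes> y)"
      using xy z by (simp add: inv_mult_group m_assoc)
    also have "\<dots> = inv (f y) \<otimes> (inv (f x) \<otimes> w \<otimes> f x) \<otimes> f y"
      using fD(4) xy z by simp
    also have "\<dots> = inv v \<otimes> w \<otimes> v"
      using xy w fD(3) by (simp add: v_def inv_mult_group m_assoc)
    finally have eq: "inv u \<otimes> w \<otimes> u = inv v \<otimes> w \<otimes> v" .
    have "w \<otimes> (u \<otimes> inv v) = u \<otimes> (inv u \<otimes> w \<otimes> u) \<otimes> inv v"
      using uv w by (simp add: m_assoc flip: m_assoc[of u "inv u"])
    also have "\<dots> = u \<otimes> inv v \<otimes> w"
      unfolding eq using uv w by (simp add: m_assoc)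
    finally show ?thesis ..
  qed
  then show ?thesis using uv by (auto simp: group_center_def u_def v_def)
qed

text \<open>Both \<open>f \<one>\<close> and the defect of multiplicativity are central, hence equal
  to the identity.\<close>

lemma trivial_center_imp_affine:
  assumes "group_center G = {\<one>}" "f \<in> quandle_auto (Conj G)" "x \<in> carrier G" "y \<in> carrier G"
  shows "f (x \<otimes> y) \<otimes> f \<one> = f x \<otimes> f y"
proof -
  note fD = quandle_auto_ConjD[OF assms(2)]
  have "f \<one> = \<one>" "f (x \<otimes> y) \<otimes> inv (f x \<otimes> f y) = \<one>"
    using quandle_auto_one_center quandle_auto_mult_mod_center assms by auto
  then show ?thesis
    using fD(3) assms(3,4) by (metis inv_equality inv_inv inv_closed m_closed r_one)
qed

lemma permutations_affine_imp_eq: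
  assumes "permutations_affine G"
  shows "quandle_auto (Conj G) = center_auto_maps G"
  unfolding quandle_auto_eq_center_auto_maps_iff
  using assms quandle_auto_ConjD(1) by (auto simp: permutations_affine_def)

section \<open>Nontrivial centre forces commutativity\<close>

text \<open>Conjugation preserves the centre and its complement, and fixes central elements. A
  central factor in the conjugating element has no effect, so translating the centre alone respects
  conjugation.\<close>

lemma central_twist_quandle_auto:
  assumes a: "a \<in> group_center G"
  shows "(\<lambda>x\<in>carrier G. if x \<in> group_center G then x \<otimes> a else x) \<in> quandle_auto (Conj G)"
proof (rule quandle_auto_ConjI)
  have mult: "x \<otimes> b \<in> group_center G" if "x \<in> group_center G" "b \<in> group_center G" for x b
    using mult_group_center[OF that] .
  show "bij_betw (\<lambda>x. if x \<in> group_center G then x \<otimes> a else x) (carrier G) (carrier G)"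
    by (rule bij_betw_byWitness[where f' = "\<lambda>x. if x \<in> group_center G then x \<otimes> inv a else x"])
      (use a inv_group_center[OF a] mult group_centerD(1) in \<open>auto simp: m_assoc\<close>)
  fix x y assume xy: "x \<in> carrier G" "y \<in> carrier G"
  have conj_center: "inv w \<otimes> z \<otimes> w = z" if "z \<in> group_center G" "w \<in> carrier G" for z w
    using group_centerD[OF that(1)] that(2) by (simp add: m_assoc flip: m_assoc[of "inv w" w])
  have conj_mem: "inv y \<otimes> x \<otimes> y \<in> group_center G \<longleftrightarrow> x \<in> group_center G"
  proof
    assume c: "inv y \<otimes> x \<otimes> y \<in> group_center G"
    have "inv (inv y) \<otimes> (inv y \<otimes> x \<otimes> y) \<otimes> inv y = x"
      using xy by (simp add: m_assoc flip: m_assoc[of y "inv y"])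
    then show "x \<in> group_center G" using conj_center[OF c, of "inv y"] c xy by simp
  qed (use conj_center xy in simp)
  have twist: "inv (y \<otimes> a) \<otimes> x \<otimes> (y \<otimes> a) = inv y \<otimes> x \<otimes> y"
  proof -
    have "inv (y \<otimes> a) \<otimes> x \<otimes> (y \<otimes> a) = inv a \<otimes> (inv y \<otimes> x \<otimes> y) \<otimes> a"
      using xy group_centerD(1)[OF a] by (simp add: inv_mult_group m_assoc)
    also have "\<dots> = inv y \<otimes> x \<otimes> y \<otimes> (inv a \<otimes> a)"
      using xy group_centerD(1)[OF a] group_centerD(2)[OF inv_group_center[OF a], of "inv y \<otimes> x \<otimes> y"]
      by (simp add: m_assoc)
    finally show ?thesis using xy group_centerD(1)[OF a] by simp
  qed
  show "(if inv y \<otimes> x \<otimes> y \<in> group_center G then inv y \<otimes> x \<otimes> y \<otimes> a else inv y \<otimes> x \<otimes> y) =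
    inv (if y \<in> group_center G then y \<otimes> a else y) \<otimes>
    (if x \<in> group_center G then x \<otimes> a else x) \<otimes> (if y \<in> group_center G then y \<otimes> a else y)"
    using xy group_centerD(1)[OF a] conj_center mult[OF _ a]
    by (auto simp: conj_mem twist)
qed

text \<open>If \<open>x\<close> and \<open>y\<close> do not commute, then \<open>x\<close>,
  \<open>y\<close> and \<open>x \<otimes> y\<close> are all noncentral, so the twist fixes them
  while sending the identity to \<open>a\<close>. The criterion then reads
  \<open>x \<otimes> y \<otimes> a = x \<otimes> y\<close>, which is false for
  \<open>a \<noteq> \<one>\<close>.\<close>

lemma eq_imp_trivial_center_or_abelian:
  assumes eq: "quandle_auto (Conj G) = center_auto_maps G"
    and "group_center G \<noteq> {\<one>}"
  shows "group_center G = carrier G"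
proof (rule ccontr)
  assume "group_center G \<noteq> carrier G"
  then obtain x where x: "x \<in> carrier G" "x \<notin> group_center G"
    by (auto simp: group_center_def)
  then obtain y where y: "y \<in> carrier G" "x \<otimes> y \<noteq> y \<otimes> x"
    by (auto simp: group_center_def)
  have one: "\<one> \<in> group_center G" by (auto simp: group_center_def)
  then obtain a where a: "a \<in> group_center G" "a \<noteq> \<one>" using assms(2) by auto
  have nc: "y \<notin> group_center G" "x \<otimes> y \<notin> group_center G"
    using x y group_centerD(2)[of y x] group_centerD(2)[of "x \<otimes> y" x] by (auto simp: m_assoc)
  let ?f = "\<lambda>x\<in>carrier G. if x \<in> group_center G then x \<otimes> a else x"
  have "?f (x \<otimes> y) \<otimes> ?f \<one> = ?f x \<otimes> ?f y"
    using eq central_twist_quandle_auto[OF a(1)] x y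
    unfolding quandle_auto_eq_center_auto_maps_iff by blast
  then have "x \<otimes> y \<otimes> a = x \<otimes> y"
    using x y nc one group_centerD(1)[OF a(1)] by simp
  then show False using a x y group_centerD(1)[OF a(1)] by simp
qed

text \<open>Conjugation is trivial here, so any permutation becomes a quandle automorphism once it
  is restricted to be extensional.\<close>

lemma abelian_eq_imp_permutations_affine:
  assumes eq: "quandle_auto (Conj G) = center_auto_maps G"
    and ab: "group_center G = carrier G"
  shows "permutations_affine G"
  unfolding permutations_affine_def
proof (intro allI impI ballI)
  fix f x y assume f: "bij_betw f (carrier G) (carrier G)" and xy: "x \<in> carrier G" "y \<in> carrier G"
  have conj: "inv v \<otimes> u \<otimes> v = u" if "u \<in> carrier G" "v \<in> carrier G" for u v
    using that group_centerD(2)[of u v] by (simp add: ab m_assoc flip: m_assoc[of "inv v" v])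
  have "restrict f (carrier G) \<in> quandle_auto (Conj G)"
    using f by (intro quandle_auto_ConjI) (auto simp: conj bij_betw_apply)
  then have "restrict f (carrier G) (x \<otimes> y) \<otimes> restrict f (carrier G) \<one> =
      restrict f (carrier G) x \<otimes> restrict f (carrier G) y"
    using eq xy unfolding quandle_auto_eq_center_auto_maps_iff by blast
  then show "f (x \<otimes> y) \<otimes> f \<one> = f x \<otimes> f y" using xy by simp
qed

section \<open>Constraints from transpositions\<close>

text \<open>The transposition fixes the identity, so the correction factor \<open>f \<one>\<close>
  disappears.\<close>

lemma permutations_affine_transpose:
  assumes aff: "permutations_affine G"
    and ab: "a \<in> carrier G" "b \<in> carrier G" "a \<noteq> \<one>" "b \<noteq> \<one>"
    and xy: "x \<in> carrier G" "y \<in> carrier G"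
  shows "Transposition.transpose a b (x \<otimes> y) =
    Transposition.transpose a b x \<otimes> Transposition.transpose a b y"
proof -
  let ?f = "Transposition.transpose a b"
  have cl: "?f z \<in> carrier G" if "z \<in> carrier G" for z
    using ab that by (auto simp: Transposition.transpose_def)
  have "bij_betw ?f (carrier G) (carrier G)"
    by (rule bij_betw_byWitness[where f' = ?f]) (use cl in auto)
  then have "?f (x \<otimes> y) \<otimes> ?f \<one> = ?f x \<otimes> ?f y"
    using aff xy unfolding permutations_affine_def by blast
  moreover have "?f \<one> = \<one>" using ab by (simp add: Transposition.transpose_def)
  ultimately show ?thesis using cl xy by simp
qed

text \<open>Swapping \<open>x\<close> with its square and applying this to
  \<open>x \<otimes> x\<close> gives \<open>x = x \<otimes> x \<otimes> (x \<otimes> x)\<close>, so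
  the cube of \<open>x\<close> is trivial.\<close>

lemma permutations_affine_square:
  assumes aff: "permutations_affine G" and x: "x \<in> carrier G" "x \<otimes> x \<noteq> \<one>"
  shows "x \<otimes> x = inv x"
proof -
  have ne: "x \<noteq> \<one>" "x \<otimes> x \<noteq> x" using x by auto
  have "x = x \<otimes> x \<otimes> (x \<otimes> x)"
    using permutations_affine_transpose[OF aff x(1) _ _ x(2) x(1) x(1)] x ne by simp
  then have "x \<otimes> (x \<otimes> x \<otimes> x) = x \<otimes> \<one>"
    using x by (simp add: m_assoc)
  then have "x \<otimes> x \<otimes> x = \<one>"
    using x by (subst (asm) l_cancel) auto
  then show ?thesis using x by (metis inv_equality m_closed inv_inv)
qed

text \<open>A further element \<open>w\<close> could be swapped with \<open>x \<otimes> y\<close>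
  while \<open>x\<close> and \<open>y\<close> stay fixed, which forces
  \<open>w = x \<otimes> y\<close>. Excluding \<open>inv x\<close> as a value of \<open>y\<close>
  keeps \<open>x \<otimes> y\<close> away from the identity.\<close>

lemma permutations_affine_carrier:
  assumes aff: "permutations_affine G"
    and x: "x \<in> carrier G" "x \<noteq> \<one>" and y: "y \<in> carrier G" "y \<notin> {\<one>, x, inv x}"
  shows "carrier G = {\<one>, x, y, x \<otimes> y}"
proof (rule ccontr)
  assume "carrier G \<noteq> {\<one>, x, y, x \<otimes> y}"
  then obtain w where w: "w \<in> carrier G" "w \<notin> {\<one>, x, y, x \<otimes> y}"
    using x y by auto
  have xy: "x \<otimes> y \<noteq> \<one>" "x \<otimes> y \<noteq> x" "x \<otimes> y \<noteq> y"
    using x y by (auto dest: inv_comm inv_equality)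
  then have "w = x \<otimes> y"
    using permutations_affine_transpose[OF aff _ w(1) xy(1) _ x(1) y(1)] x y w by auto
  then show False using w by simp
qed

text \<open>Otherwise \<open>x \<otimes> x\<close> is \<open>inv x\<close>. Among the four elements
  of the group only \<open>y\<close> could equal it, but \<open>y \<noteq> inv x\<close>.\<close>

lemma permutations_affine_involution:
  assumes aff: "permutations_affine G"
    and x: "x \<in> carrier G" "x \<noteq> \<one>" and y: "y \<in> carrier G" "y \<notin> {\<one>, x, inv x}"
  shows "x \<otimes> x = \<one>"
proof (rule ccontr)
  assume xx: "x \<otimes> x \<noteq> \<one>"
  then have "x \<otimes> x = inv x" using permutations_affine_square aff x by blast
  moreover have "x \<otimes> x \<in> {\<one>, x, y, x \<otimes> y}"
    using m_closed[OF x(1) x(1)] unfolding permutations_affine_carrier[OF assms] .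
  moreover have "x \<otimes> x \<noteq> x" "x \<otimes> x \<noteq> x \<otimes> y"
    using x y by auto
  ultimately show False using y xx by auto
qed

section \<open>Recognising the three groups\<close>

text \<open>The explicit maps below run from the integer models into \<open>G\<close>, so the
  isomorphism has to be reversed.\<close>

lemma is_iso_if_iso_into:
  assumes "group H" "h \<in> iso H G"
  shows "G \<cong> H"
  using assms by (metis group.iso_sym is_iso_def empty_iff)

lemma iso_Z2I:
  assumes x: "x \<noteq> \<one>" "x \<otimes> x = \<one>" and G: "carrier G = {\<one>, x}"
  shows "G \<cong> integer_mod_group 2"
proof -
  have "x \<in> carrier G" using G by auto
  then have "(\<lambda>i. if i = 0 then \<one> else x) \<in> iso (integer_mod_group 2) G"
    using x by (auto simp: iso_def hom_def bij_betw_def inj_on_def carrier_integer_mod_group_2 G)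
  then show ?thesis
    by (rule is_iso_if_iso_into[OF group_integer_mod_group])
qed

lemma iso_Z3I:
  assumes x: "x \<noteq> \<one>" "x \<otimes> x \<noteq> \<one>" "x \<otimes> x \<otimes> x = \<one>" and G: "carrier G = {\<one>, x, x \<otimes> x}"
  shows "G \<cong> integer_mod_group 3"
proof -
  have xc: "x \<in> carrier G" unfolding G by simp
  \<comment> \<open>The products in \<open>xxx\<close> and \<open>xxxx\<close> are those whose
    exponents wrap around modulo 3.\<close>
  have xxx: "x \<otimes> (x \<otimes> x) = \<one>" and ne: "x \<otimes> x \<noteq> x"
    using x xc by (simp_all flip: m_assoc)
  have xxxx: "x \<otimes> x \<otimes> (x \<otimes> x) = x"
    using xc by (simp add: m_assoc xxx)
  \<comment> \<open>The power map sending \<open>i\<close> to the \<open>i\<close>-th power of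
    \<open>x\<close>.\<close>
  let ?h = "\<lambda>i :: int. if i = 0 then \<one> else if i = 1 then x else x \<otimes> x"
  have "?h \<in> hom (integer_mod_group 3) G"
    unfolding hom_def using xc by (auto simp: carrier_integer_mod_group_3 xxx xxxx x(3))
  moreover have "inj_on ?h (carrier (integer_mod_group 3))"
    using x ne by (auto simp: inj_on_def carrier_integer_mod_group_3)
  moreover have "?h ` carrier (integer_mod_group 3) = carrier G"
    unfolding G carrier_integer_mod_group_3 by auto
  ultimately have "?h \<in> iso (integer_mod_group 3) G"
    by (simp add: iso_def bij_betw_def)
  then show ?thesis
    by (rule is_iso_if_iso_into[OF group_integer_mod_group])
qed

lemma iso_KleinI:
  assumes x: "x \<noteq> \<one>" "x \<otimes> x = \<one>" and y: "y \<noteq> \<one>" "y \<otimes> y = \<one>" and ne: "x \<noteq> y"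
    and G: "carrier G = {\<one>, x, y, x \<otimes> y}"
  shows "G \<cong> integer_mod_group 2 \<times>\<times> integer_mod_group 2"
proof -
  have c: "x \<in> carrier G" "y \<in> carrier G" unfolding G by simp_all
  have xy: "x \<otimes> y \<noteq> \<one>" "x \<otimes> y \<noteq> x" "x \<otimes> y \<noteq> y"
    using c x y ne by (auto dest: inv_equality simp: inv_equality)
  \<comment> \<open>Commutativity is obtained by elimination: the product in the other order is one
    of four elements, and three are impossible.\<close>
  have "y \<otimes> x \<in> {\<one>, x, y, x \<otimes> y}" using m_closed[OF c(2,1)] unfolding G .
  moreover have "y \<otimes> x \<noteq> \<one>" "y \<otimes> x \<noteq> x" "y \<otimes> x \<noteq> y"
    using c x y ne by (auto dest: inv_equality simp: inv_equality)
  ultimately have yx: "y \<otimes> x = x \<otimes> y" by auto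
  have xxy: "x \<otimes> (x \<otimes> y) = y" using c x by (simp flip: m_assoc)
  have yxy: "y \<otimes> (x \<otimes> y) = x" using c y by (simp flip: yx) (simp flip: m_assoc)
  \<comment> \<open>The exponents of \<open>x\<close> and \<open>y\<close> serve as
    coordinates.\<close>
  let ?h = "\<lambda>(i :: int, j :: int). (if i = 0 then \<one> else x) \<otimes> (if j = 0 then \<one> else y)"
  let ?K = "integer_mod_group 2 \<times>\<times> integer_mod_group 2"
  have K: "carrier ?K = {(0, 0), (0, 1), (1, 0), (1, 1)}"
    by (auto simp: carrier_integer_mod_group_2)
  have "?h \<in> hom ?K G"
    unfolding hom_def K using c x y by (auto simp: m_assoc xxy yxy yx)
  moreover have "inj_on ?h (carrier ?K)"
    unfolding K using c x y ne xy by (auto simp: inj_on_def)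
  moreover have "?h ` carrier ?K = carrier G"
    unfolding G K using c by auto
  ultimately have "?h \<in> iso ?K G"
    by (simp add: iso_def bij_betw_def)
  then show ?thesis
    by (rule is_iso_if_iso_into[OF DirProd_group[OF group_integer_mod_group group_integer_mod_group]])
qed

text \<open>Fix \<open>x \<noteq> \<one>\<close>. If the group is exhausted by the identity,
  \<open>x\<close> and \<open>inv x\<close>, it has order 2 or 3, according to whether
  \<open>x\<close> is an involution. Any further element \<open>y\<close> gives the Klein
  four-group.\<close>

lemma permutations_affine_classification:
  assumes aff: "permutations_affine G"
  shows "carrier G = {\<one>} \<or> G \<cong> integer_mod_group 2 \<or>
    G \<cong> integer_mod_group 2 \<times>\<times> integer_mod_group 2 \<or> G \<cong> integer_mod_group 3"
proof (cases "carrier G = {\<one>}")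
  case False
  then obtain x where x: "x \<in> carrier G" "x \<noteq> \<one>" by auto
  show ?thesis
  proof (cases "carrier G = {\<one>, x, inv x}")
    case True
    show ?thesis
    proof (cases "x \<otimes> x = \<one>")
      case 1: True
      then have "inv x = x" using x by (simp add: inv_equality)
      then show ?thesis using iso_Z2I[of x] True x 1 by simp
    next
      case 1: False
      then have xx: "x \<otimes> x = inv x" using permutations_affine_square aff x by simp
      then have "x \<otimes> x \<otimes> x = \<one>" using x by (simp only: l_inv)
      moreover have "carrier G = {\<one>, x, x \<otimes> x}" using True by (simp only: xx)
      ultimately have "G \<cong> integer_mod_group 3" using iso_Z3I[of x] x 1 by blast
      then show ?thesis by simp
    qed
  next
    case False
    then obtain y where y: "y \<in> carrier G" "y \<notin> {\<one>, x, inv x}" using x by auto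
    \<comment> \<open>The conditions on \<open>x\<close> and \<open>y\<close> are symmetric, so
      \<open>permutations_affine_involution\<close> applies to each of them.\<close>
    then have "y \<noteq> \<one>" "x \<noteq> y" "x \<notin> {\<one>, y, inv y}" using x by auto
    then have "G \<cong> integer_mod_group 2 \<times>\<times> integer_mod_group 2"
      using iso_KleinI[OF x(2) _ _ _ _ permutations_affine_carrier[OF aff x y]]
        permutations_affine_involution[OF aff x y] permutations_affine_involution[OF aff y(1) _ x(1)]
      by blast
    then show ?thesis by simp
  qed
qed simp

end

theorem theorem4p9:
  fixes G (structure)
  assumes "group G" and "finite (carrier G)"
  shows "carrier (quandle_AutoGroup (Conj G)) = center_auto_maps G \<longleftrightarrow>
    group_center G = {\<one>} \<or>
    G \<cong> integer_mod_group 2 \<or>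
    G \<cong> integer_mod_group 2 \<times>\<times> integer_mod_group 2 \<or>
    G \<cong> integer_mod_group 3"
proof -
  interpret group G by fact
  show ?thesis
    unfolding carrier_quandle_AutoGroup
  proof
    assume eq: "quandle_auto (Conj G) = center_auto_maps G"
    show "group_center G = {\<one>} \<or> G \<cong> integer_mod_group 2 \<or>
      G \<cong> integer_mod_group 2 \<times>\<times> integer_mod_group 2 \<or> G \<cong> integer_mod_group 3"
    proof (cases "group_center G = {\<one>}")
      case False
      then have "group_center G = carrier G"
        by (rule eq_imp_trivial_center_or_abelian[OF eq])
      then show ?thesis
        using permutations_affine_classification[OF abelian_eq_imp_permutations_affine[OF eq]] by auto
    qed simp
  next
    assume "group_center G = {\<one>} \<or> G \<cong> integer_mod_group 2 \<or>
      G \<cong> integer_mod_group 2 \<times>\<times> integer_mod_group 2 \<or> G \<cong> integer_mod_group 3"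
    \<comment> \<open>The three groups need no separate treatment of automorphisms: each inherits
      the affine property from its integer model.\<close>
    then have "group_center G = {\<one>} \<or> permutations_affine G"
      using permutations_affine_iso[OF is_group group_integer_mod_group _ permutations_affine_Z2]
        permutations_affine_iso[OF is_group group_integer_mod_group _ permutations_affine_Z3]
        permutations_affine_iso[OF is_group
          DirProd_group[OF group_integer_mod_group group_integer_mod_group] _ permutations_affine_Klein]
      by blast
    then show "quandle_auto (Conj G) = center_auto_maps G"
    proof
      assume "group_center G = {\<one>}"
      then show ?thesis
        unfolding quandle_auto_eq_center_auto_maps_iff by (blast intro: trivial_center_imp_affine)
    qed (rule permutations_affine_imp_eq)
  qed
qed

end
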